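(* Let $F$ be a free group with finite basis $\{a_1,\dots,a_m\}$ and let $\phi$ be an automorphism of $F$ that is positive with respect to this basis. There exists a positive integer $k$ such that $\phi_0:=\phi^k$ has the following properties, where $x,y$ denote letters of the basis and supports, strata and exponential letters are those of $\phi_0$: 1. Each letter $x$ appears in its own image under $\phi_0$. 2. Each exponential letter $x$ appears at least $3$ times in its own image under $\phi_0$. 3. For all $x$, each letter $y\in\mathrm{Supp}(x)$ appears in $\phi_0(x)$. 4. For all $x$ and all $j\ge1$, the leftmost and rightmost letters of $\phi_0^j(x)$ are the same as those of $\phi_0(x)$. 5. For all $x$, all $j\ge1$ and all strata $\Sigma\subseteq\mathrm{Supp}(x)$, the leftmost (respectively, rightmost) letter from $\Sigma$ in the reduced word $\phi_0^j(x)$ is the same as the leftmost (respectively, rightmost) letter from $\Sigma$ in $\phi_0(x)$.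
   Context: $\phi$ is positive with respect to the basis if the reduced words $\phi(a_i)$ contain no inverse letters $a_j^{-1}$. For a positive automorphism $\psi$ and a basis letter $x$: $\mathrm{Supp}(x)$ is the set of all letters which appear in the reduced word $\psi^j(x)$ for some $j\ge0$; the stratum of $x$ is $\Sigma(x)=\{y\in\mathrm{Supp}(x):\mathrm{Supp}(y)=\mathrm{Supp}(x)\}$. The stratum $\Sigma(x)$ is parabolic if $x\notin\mathrm{Supp}(y)$ for all $y\in\mathrm{Supp}(x)\smallsetminus\{x\}$, and exponential if $\Sigma(x)=\Sigma(y)$ for some $y\ne x$; the letter $x$ is called exponential if $\Sigma(x)$ is exponential. *)

theory Defs
  imports "HOL-Algebra.Group"
begin

text \<open>
  Words over a set \<open>A\<close> of group elements and their formal inverses: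
  \<open>(a, True)\<close> stands for the letter \<open>a\<close> and \<open>(a, False)\<close> for the inverse letter of \<open>a\<close>.
\<close>

definition word_value :: "('a, 'b) monoid_scheme \<Rightarrow> ('a \<times> bool) list \<Rightarrow> 'a" where
  "word_value G w =
     foldr (\<lambda>(a, e) g. (if e then a else inv\<^bsub>G\<^esub> a) \<otimes>\<^bsub>G\<^esub> g) w \<one>\<^bsub>G\<^esub>"

definition reduced_words :: "'a set \<Rightarrow> ('a \<times> bool) list set" where
  "reduced_words A =
     {w. fst ` set w \<subseteq> A \<and> successively (\<lambda>(a, e) (b, f). \<not> (a = b \<and> e \<noteq> f)) w}"

text \<open>\<open>G\<close> is free on \<open>A\<close>: every element is represented by exactly one reduced word over \<open>A\<close>.\<close>

definition free_basis :: "('a, 'b) monoid_scheme \<Rightarrow> 'a set \<Rightarrow> bool" where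
  "free_basis G A \<longleftrightarrow> A \<subseteq> carrier G \<and>
     (\<forall>g \<in> carrier G. \<exists>!w. w \<in> reduced_words A \<and> word_value G w = g)"

definition reduced_word :: "('a, 'b) monoid_scheme \<Rightarrow> 'a set \<Rightarrow> 'a \<Rightarrow> ('a \<times> bool) list" where
  "reduced_word G A g = (THE w. w \<in> reduced_words A \<and> word_value G w = g)"

lemma reduced_word_correct:
  assumes "free_basis G A" and "g \<in> carrier G"
  shows "reduced_word G A g \<in> reduced_words A" and "word_value G (reduced_word G A g) = g"
proof -
  have "\<exists>!w. w \<in> reduced_words A \<and> word_value G w = g"
    using assms unfolding free_basis_def by blast
  from theI'[OF this] show "reduced_word G A g \<in> reduced_words A"
    and "word_value G (reduced_word G A g) = g"
    unfolding reduced_word_def by blast+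
qed

definition positive_on_basis :: "('a, 'b) monoid_scheme \<Rightarrow> 'a set \<Rightarrow> ('a \<Rightarrow> 'a) \<Rightarrow> bool" where
  "positive_on_basis G A \<phi> \<longleftrightarrow> (\<forall>x \<in> A. \<forall>y \<in> A. (y, False) \<notin> set (reduced_word G A (\<phi> x)))"

text \<open>
  The following notions are meant for positive automorphisms \<open>\<psi>\<close>, for which the reduced words
  of all \<open>(\<psi> ^^ j) x\<close> with \<open>x \<in> A\<close> consist of letters of the form \<open>(y, True)\<close>.
\<close>

definition Supp :: "('a, 'b) monoid_scheme \<Rightarrow> 'a set \<Rightarrow> ('a \<Rightarrow> 'a) \<Rightarrow> 'a \<Rightarrow> 'a set" where
  "Supp G A \<psi> x = {y \<in> A. \<exists>j::nat. (y, True) \<in> set (reduced_word G A ((\<psi> ^^ j) x))}"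

definition stratum :: "('a, 'b) monoid_scheme \<Rightarrow> 'a set \<Rightarrow> ('a \<Rightarrow> 'a) \<Rightarrow> 'a \<Rightarrow> 'a set" where
  "stratum G A \<psi> x = {y \<in> Supp G A \<psi> x. Supp G A \<psi> y = Supp G A \<psi> x}"

definition exponential_letter ::
    "('a, 'b) monoid_scheme \<Rightarrow> 'a set \<Rightarrow> ('a \<Rightarrow> 'a) \<Rightarrow> 'a \<Rightarrow> bool" where
  "exponential_letter G A \<psi> x \<longleftrightarrow>
     x \<in> A \<and> (\<exists>y \<in> A. y \<noteq> x \<and> stratum G A \<psi> x = stratum G A \<psi> y)"

text \<open>
  As relations, these assert in particular that a letter from \<open>S\<close> does occur in \<open>w\<close>.
\<close>

definition leftmost_letter_from :: "'a set \<Rightarrow> ('a \<times> bool) list \<Rightarrow> 'a \<Rightarrow> bool" where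
  "leftmost_letter_from S w z \<longleftrightarrow>
     z \<in> S \<and> (\<exists>u v. w = u @ (z, True) # v \<and> fst ` set u \<inter> S = {})"

definition rightmost_letter_from :: "'a set \<Rightarrow> ('a \<times> bool) list \<Rightarrow> 'a \<Rightarrow> bool" where
  "rightmost_letter_from S w z \<longleftrightarrow>
     z \<in> S \<and> (\<exists>u v. w = u @ (z, True) # v \<and> fst ` set v \<inter> S = {})"

end

theory Submission
  imports Defs
begin

text \<open>
  A positive automorphism acts on basis letters as a substitution \<open>s\<close> of positive words. For every
  set \<open>S\<close> of letters, the first letter of \<open>s\<^sup>n(x)\<close> lying in \<open>S\<close> is determined
  by \<open>s(x)\<close> and by the corresponding data for \<open>s\<^sup>n\<^sup>-\<^sup>1\<close>. There are only finitely many
  possible data, so they are eventually periodic in \<open>n\<close>, and for suitable \<open>K\<close> they agree for all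
  \<open>s\<^sup>K\<^sup>j\<close> with \<open>j \<ge> 1\<close>. This handles supports, leftmost and (by reversal) rightmost letters
  simultaneously. Invertibility is only used to see that each letter \<open>x\<close> occurs in some \<open>s\<^sup>n(x)\<close>
  with \<open>n \<ge> 1\<close>: precomposition with the automorphism is a bijection of the homomorphisms to
  \<open>\<int>/2\<close>, and if \<open>x\<close> did not recur, the \<open>\<int>/2\<close>-valued functions on a set of letters would be an
  image of those on a smaller set. The fourth power of an iterate with these properties then gives
  the multiplicity of exponential letters.
\<close>

section \<open>Iterated substitutions\<close>

primrec subst_pow :: "('a \<Rightarrow> 'a list) \<Rightarrow> nat \<Rightarrow> 'a \<Rightarrow> 'a list" where
  "subst_pow s 0 x = [x]"
| "subst_pow s (Suc n) x = concat (map s (subst_pow s n x))"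

lemma concat_map_concat_map:
  "concat (map f (concat (map g xs))) = concat (map (\<lambda>x. concat (map f (g x))) xs)"
  by (induction xs) auto

lemma subst_pow_add:
  "subst_pow s (m + n) x = concat (map (subst_pow s m) (subst_pow s n x))"
proof (induction m)
  case 0
  have "concat (map (subst_pow s 0) w) = w" for w :: "'a list"
    by (induction w) auto
  then show ?case by simp
next
  case (Suc m)
  then show ?case by (simp add: concat_map_concat_map)
qed

lemma subst_pow_Suc_left: "subst_pow s (Suc n) x = concat (map (subst_pow s n) (s x))"
  using subst_pow_add[of s n 1 x] by simp

lemma set_subst_pow_add: "set (subst_pow s (m + n) x) = (\<Union>y\<in>set (subst_pow s n x). set (subst_pow s m y))"
  by (simp add: subst_pow_add)

lemma set_subst_pow_subset:
  assumes "\<forall>y\<in>A. set (s y) \<subseteq> A" and "x \<in> A"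
  shows "set (subst_pow s n x) \<subseteq> A"
  using assms by (induction n) auto

lemma rev_subst_pow: "rev (subst_pow s n x) = subst_pow (\<lambda>y. rev (s y)) n x"
proof (induction n)
  case (Suc n)
  have "rev (subst_pow s (Suc n) x) = concat (map (\<lambda>y. rev (s y)) (rev (subst_pow s n x)))"
    by (simp add: rev_concat rev_map comp_def)
  with Suc show ?case by simp
qed simp

lemma subst_pow_recurrent_mult:
  assumes "x \<in> set (subst_pow s n x)"
  shows "x \<in> set (subst_pow s (n * j) x)"
proof (induction j)
  case (Suc j)
  then show ?case using assms by (auto simp: set_subst_pow_add)
qed simp

lemma find_concat_map:
  "find P (concat (map f w)) =
     (case find (\<lambda>y. find P (f y) \<noteq> None) w of None \<Rightarrow> None | Some y \<Rightarrow> find P (f y))"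
proof (induction w)
  case (Cons a w)
  have "find P (u @ v) = (case find P u of None \<Rightarrow> find P v | Some z \<Rightarrow> Some z)" for u v
    by (induction u) auto
  then have "find P (concat (map f (a # w))) =
      (case find P (f a) of None \<Rightarrow> find P (concat (map f w)) | Some z \<Rightarrow> Some z)"
    by simp
  with Cons show ?case by (cases "find P (f a)") simp_all
qed simp

lemma find_SomeD: "find P w = Some y \<Longrightarrow> y \<in> set w \<and> P y"
  by (induction w) (auto split: if_splits)

lemma find_mem_cong_sets:
  assumes "set u \<subseteq> A" "set v \<subseteq> A"
    and "\<And>S. S \<subseteq> A \<Longrightarrow> find (\<lambda>z. z \<in> S) u = find (\<lambda>z. z \<in> S) v"
  shows "find (\<lambda>z. z \<in> S) u = find (\<lambda>z. z \<in> S) v"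
proof -
  have "find (\<lambda>z. z \<in> S) w = find (\<lambda>z. z \<in> S \<inter> A) w" if "set w \<subseteq> A" for w
    using that by (intro find_cong) auto
  with assms show ?thesis by (metis inf_le2)
qed

lemma find_subst_pow_Suc_cong:
  assumes closed: "\<forall>y\<in>A. set (s y) \<subseteq> A"
    and eq: "\<And>x S. x \<in> A \<Longrightarrow> find (\<lambda>z. z \<in> S) (subst_pow s i x) = find (\<lambda>z. z \<in> S) (subst_pow s j x)"
    and x: "x \<in> A"
  shows "find (\<lambda>z. z \<in> S) (subst_pow s (Suc i) x) = find (\<lambda>z. z \<in> S) (subst_pow s (Suc j) x)"
proof -
  let ?Q = "\<lambda>i y. find (\<lambda>z. z \<in> S) (subst_pow s i y)"
  have "find (\<lambda>y. ?Q i y \<noteq> None) (s x) = find (\<lambda>y. ?Q j y \<noteq> None) (s x)"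
    using bspec[OF closed x] eq by (intro find_cong) auto
  moreover have "?Q i y = ?Q j y" if "find (\<lambda>y. ?Q j y \<noteq> None) (s x) = Some y" for y
    using find_SomeD[OF that] bspec[OF closed x] eq by blast
  ultimately show ?thesis
    unfolding subst_pow_Suc_left find_concat_map
    by (metis (no_types, lifting) option.case_eq_if option.collapse)
qed

lemma find_subst_pow_eventually_periodic:
  assumes fin: "finite A" and closed: "\<forall>y\<in>A. set (s y) \<subseteq> A"
  shows "\<exists>i p. p > 0 \<and> (\<forall>n\<ge>i. \<forall>q. \<forall>x\<in>A. \<forall>S.
       find (\<lambda>z. z \<in> S) (subst_pow s (n + p * q) x) = find (\<lambda>z. z \<in> S) (subst_pow s n x))"
proof -
  define D where "D n = {(x, S, z). x \<in> A \<and> S \<subseteq> A \<and> find (\<lambda>z. z \<in> S) (subst_pow s n x) = Some z}" for n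
  have sub: "set (subst_pow s n x) \<subseteq> A" if "x \<in> A" for n x
    using set_subst_pow_subset[OF closed that] .
  have "z \<in> A" if "x \<in> A" "find (\<lambda>z. z \<in> S) (subst_pow s n x) = Some z" for n x S z
    using find_SomeD[OF that(2)] sub[OF that(1)] by blast
  then have "range D \<subseteq> Pow (A \<times> Pow A \<times> A)"
    by (auto simp: D_def)
  then have "finite (range D)"
    by (rule finite_subset) (use fin in auto)
  then have "\<not> inj D"
    using finite_imageD infinite_UNIV_nat by blast
  then obtain i j where ij: "D i = D j" "i < j"
    by (metis injI linorder_neqE_nat)
  have base: "find (\<lambda>z. z \<in> S) (subst_pow s i x) = find (\<lambda>z. z \<in> S) (subst_pow s j x)"
    if x: "x \<in> A" for x S
  proof (rule find_mem_cong_sets[OF sub[OF x] sub[OF x]])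
    fix S assume "S \<subseteq> A"
    then have "find (\<lambda>z. z \<in> S) (subst_pow s i x) = Some z \<longleftrightarrow>
        find (\<lambda>z. z \<in> S) (subst_pow s j x) = Some z" for z
      using ij(1) x by (auto simp: D_def set_eq_iff)
    then show "find (\<lambda>z. z \<in> S) (subst_pow s i x) = find (\<lambda>z. z \<in> S) (subst_pow s j x)"
      by (metis not_None_eq)
  qed
  have shift: "\<forall>x\<in>A. \<forall>S. find (\<lambda>z. z \<in> S) (subst_pow s (i + d) x) =
      find (\<lambda>z. z \<in> S) (subst_pow s (j + d) x)" for d
  proof (induction d)
    case (Suc d)
    show ?case
      unfolding add_Suc_right using Suc
      by (intro ballI allI find_subst_pow_Suc_cong[OF closed]) auto
  qed (use base in simp)
  have period: "find (\<lambda>z. z \<in> S) (subst_pow s (n + (j - i) * q) x) = find (\<lambda>z. z \<in> S) (subst_pow s n x)"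
    if "n \<ge> i" "x \<in> A" for n q x S
  proof (induction q)
    case (Suc q)
    let ?d = "n + (j - i) * q - i"
    have "n + (j - i) * Suc q = j + ?d" "n + (j - i) * q = i + ?d"
      using that(1) ij(2) by auto
    moreover have "find (\<lambda>z. z \<in> S) (subst_pow s (i + ?d) x) = find (\<lambda>z. z \<in> S) (subst_pow s (j + ?d) x)"
      using shift that(2) by blast
    ultimately show ?case using Suc by (simp only:)
  qed simp
  from ij(2) have "j - i > 0" by simp
  with period show ?thesis by blast
qed

lemma find_subst_pow_stable:
  assumes fin: "finite A" and closed: "\<forall>y\<in>A. set (s y) \<subseteq> A"
  shows "\<exists>K>0. \<forall>j\<ge>1. \<forall>x\<in>A. \<forall>S.
       find (\<lambda>z. z \<in> S) (subst_pow s (K * j) x) = find (\<lambda>z. z \<in> S) (subst_pow s K x) \<and>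
       find (\<lambda>z. z \<in> S) (rev (subst_pow s (K * j) x)) = find (\<lambda>z. z \<in> S) (rev (subst_pow s K x))"
proof -
  obtain i p where p: "p > 0" "\<forall>n\<ge>i. \<forall>q. \<forall>x\<in>A. \<forall>S.
       find (\<lambda>z. z \<in> S) (subst_pow s (n + p * q) x) = find (\<lambda>z. z \<in> S) (subst_pow s n x)"
    using find_subst_pow_eventually_periodic[OF fin closed] by blast
  have "\<forall>y\<in>A. set (rev (s y)) \<subseteq> A"
    using closed by simp
  from find_subst_pow_eventually_periodic[OF fin this]
  obtain i' p' where p': "p' > 0" "\<forall>n\<ge>i'. \<forall>q. \<forall>x\<in>A. \<forall>S.
       find (\<lambda>z. z \<in> S) (subst_pow (\<lambda>y. rev (s y)) (n + p' * q) x) =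
       find (\<lambda>z. z \<in> S) (subst_pow (\<lambda>y. rev (s y)) n x)"
    by blast
  define K where "K = p * p' * (i + i' + 1)"
  have "1 * (i + i' + 1) \<le> p * p' * (i + i' + 1)"
    using p(1) p'(1) by (intro mult_le_mono1) (simp add: Suc_le_eq)
  then have "i + i' + 1 \<le> K" unfolding K_def by simp
  then have K: "K > 0" "K \<ge> i" "K \<ge> i'" by linarith+
  have mult: "K * j = K + p * (p' * (i + i' + 1) * (j - 1))" "K * j = K + p' * (p * (i + i' + 1) * (j - 1))"
    if "j \<ge> 1" for j
  proof -
    have "K * j = K + K * (j - 1)" using that by (cases j) auto
    moreover have "K = p * (p' * (i + i' + 1))" "K = p' * (p * (i + i' + 1))"
      unfolding K_def by (simp_all only: ac_simps)
    ultimately show "K * j = K + p * (p' * (i + i' + 1) * (j - 1))" "K * j = K + p' * (p * (i + i' + 1) * (j - 1))"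
      by (metis mult.assoc)+
  qed
  show ?thesis
  proof (intro exI[of _ K] conjI K(1) allI impI ballI)
    fix j x and S :: "'a set" assume "j \<ge> (1::nat)" "x \<in> A"
    show "find (\<lambda>z. z \<in> S) (subst_pow s (K * j) x) = find (\<lambda>z. z \<in> S) (subst_pow s K x)"
      unfolding mult(1)[OF \<open>j \<ge> 1\<close>] using p(2) K(2) \<open>x \<in> A\<close> by blast
    show "find (\<lambda>z. z \<in> S) (rev (subst_pow s (K * j) x)) = find (\<lambda>z. z \<in> S) (rev (subst_pow s K x))"
      unfolding rev_subst_pow mult(2)[OF \<open>j \<ge> 1\<close>] using p'(2) K(3) \<open>x \<in> A\<close> by blast
  qed
qed

lemma set_eq_of_find_eq:
  assumes "\<And>S. find (\<lambda>z. z \<in> S) u = find (\<lambda>z. z \<in> S) v"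
  shows "set u = set v"
proof -
  have find_singleton: "y \<in> set w \<longleftrightarrow> find (\<lambda>z. z \<in> {y}) w \<noteq> None" for y :: 'a and w
    by (auto simp: find_None_iff)
  show ?thesis unfolding set_eq_iff find_singleton assms by simp
qed

lemma count_list_concat_map: "count_list (concat (map f w)) x = (\<Sum>y\<leftarrow>w. count_list (f y) x)"
  by (induction w) auto

lemma count_list_subst_pow_add:
  "count_list (subst_pow s n x) y * count_list (subst_pow s m y) z \<le> count_list (subst_pow s (m + n) x) z"
proof -
  have "count_list w y * f y \<le> (\<Sum>y\<leftarrow>w. f y)" for w and f :: "'a \<Rightarrow> nat"
    by (induction w) auto
  then show ?thesis by (simp add: subst_pow_add count_list_concat_map)
qed

lemma count_list_subst_pow_add2:
  assumes "y \<noteq> y'"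
  shows "count_list (subst_pow s n x) y * count_list (subst_pow s m y) z +
         count_list (subst_pow s n x) y' * count_list (subst_pow s m y') z
       \<le> count_list (subst_pow s (m + n) x) z"
proof -
  have "count_list w y * f y + count_list w y' * f y' \<le> (\<Sum>y\<leftarrow>w. f y)" for w and f :: "'a \<Rightarrow> nat"
    using assms by (induction w) auto
  then show ?thesis by (simp add: subst_pow_add count_list_concat_map)
qed

lemma count_list_subst_pow_4:
  assumes "x \<noteq> y" "x \<in> set (subst_pow s n x)" "y \<in> set (subst_pow s n x)" "x \<in> set (subst_pow s n y)"
  shows "count_list (subst_pow s (n * 4) x) x \<ge> 4"
proof -
  let ?c = "\<lambda>n x y. count_list (subst_pow s n x) y"
  have pos: "?c n x x \<ge> 1" "?c n x y \<ge> 1" "?c n y x \<ge> 1"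
    using assms(2-4) count_list_0_iff[of _ x] count_list_0_iff[of _ y] by (metis One_nat_def Suc_leI neq0_conv)+
  have "1 * 1 + 1 * 1 \<le> ?c n x x * ?c n x x + ?c n x y * ?c n y x"
    using pos by (intro add_mono mult_le_mono)
  also have "\<dots> \<le> ?c (n + n) x x"
    by (rule count_list_subst_pow_add2[OF assms(1)])
  finally have "2 * 2 \<le> ?c (n + n) x x * ?c (n + n) x x"
    by (intro mult_le_mono) auto
  also have "\<dots> \<le> ?c ((n + n) + (n + n)) x x"
    by (rule count_list_subst_pow_add)
  finally show ?thesis by (simp add: algebra_simps numeral_eq_Suc)
qed

text \<open>The hypothesis says that the transposed incidence matrix of \<open>s\<close> is surjective modulo 2.\<close>

lemma subst_pow_recurrent:
  assumes fin: "finite A" and closed: "\<forall>y\<in>A. set (s y) \<subseteq> A"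
    and surj: "\<And>g. \<exists>f. \<forall>y\<in>A. g y = odd (length (filter f (s y)))"
    and x: "x \<in> A"
  shows "\<exists>n\<ge>1. x \<in> set (subst_pow s n x)"
proof (rule ccontr)
  assume no: "\<not> ?thesis"
  define B where "B = (\<Union>n\<in>{1..}. set (subst_pow s n x))"
  have xB: "x \<notin> B" using no by (auto simp: B_def)
  have BA: "B \<subseteq> A"
    unfolding B_def by (intro UN_least set_subst_pow_subset closed x)
  then have finB: "finite B" using fin finite_subset by blast
  have step: "set (s y) \<subseteq> B" if "y \<in> insert x B" for y
  proof -
    obtain n where "y \<in> set (subst_pow s n x)"
    proof (cases "y = x")
      case True
      then show ?thesis using that[of 0] by simp
    next
      case False
      with \<open>y \<in> insert x B\<close> show ?thesis using that by (auto simp: B_def)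
    qed
    then have "set (s y) \<subseteq> set (subst_pow s (Suc n) x)" by auto
    then show ?thesis unfolding B_def by fastforce
  qed
  define h where "h T = {y \<in> insert x B. odd (length (filter (\<lambda>z. z \<in> T) (s y)))}" for T
  have "Pow (insert x B) \<subseteq> h ` Pow B"
  proof
    fix Q assume Q: "Q \<in> Pow (insert x B)"
    obtain f where f: "\<forall>y\<in>A. (y \<in> Q) = odd (length (filter f (s y)))"
      using surj[of "\<lambda>y. y \<in> Q"] by blast
    have "y \<in> Q \<longleftrightarrow> y \<in> h {z \<in> B. f z}" if y: "y \<in> insert x B" for y
    proof -
      have "filter f (s y) = filter (\<lambda>z. z \<in> {z \<in> B. f z}) (s y)"
        using step[OF y] by (intro filter_cong) auto
      moreover have "y \<in> A" using y x BA by auto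
      ultimately show ?thesis using f y unfolding h_def by simp
    qed
    moreover have "h {z \<in> B. f z} \<subseteq> insert x B" by (auto simp: h_def)
    ultimately have "Q = h {z \<in> B. f z}" using Q by blast
    then show "Q \<in> h ` Pow B" by blast
  qed
  then have "card (Pow (insert x B)) \<le> card (Pow B)"
    by (rule surj_card_le[rotated]) (use finB in simp)
  then show False using finB xB by (simp add: card_Pow)
qed

lemma subst_pow_good_power:
  assumes fin: "finite A" and closed: "\<forall>y\<in>A. set (s y) \<subseteq> A"
    and rec: "\<And>x. x \<in> A \<Longrightarrow> \<exists>n\<ge>1. x \<in> set (subst_pow s n x)"
  shows "\<exists>K>0. (\<forall>x\<in>A. x \<in> set (subst_pow s K x)) \<and>
    (\<forall>x\<in>A. \<forall>y\<in>A. x \<noteq> y \<longrightarrow> y \<in> set (subst_pow s K x) \<longrightarrow>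
       x \<in> set (subst_pow s K y) \<longrightarrow> count_list (subst_pow s K x) x \<ge> 3) \<and>
    (\<forall>j\<ge>1. \<forall>x\<in>A. \<forall>S.
       find (\<lambda>z. z \<in> S) (subst_pow s (K * j) x) = find (\<lambda>z. z \<in> S) (subst_pow s K x) \<and>
       find (\<lambda>z. z \<in> S) (rev (subst_pow s (K * j) x)) = find (\<lambda>z. z \<in> S) (rev (subst_pow s K x)))"
proof -
  obtain k where k: "k > 0" "\<forall>j\<ge>1. \<forall>x\<in>A. \<forall>S.
       find (\<lambda>z. z \<in> S) (subst_pow s (k * j) x) = find (\<lambda>z. z \<in> S) (subst_pow s k x) \<and>
       find (\<lambda>z. z \<in> S) (rev (subst_pow s (k * j) x)) = find (\<lambda>z. z \<in> S) (rev (subst_pow s k x))"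
    using find_subst_pow_stable[OF fin closed] by blast
  have set_k: "set (subst_pow s (k * j) x) = set (subst_pow s k x)" if "j \<ge> 1" "x \<in> A" for j x
    using k(2) that by (intro set_eq_of_find_eq) blast
  have self: "x \<in> set (subst_pow s k x)" if x: "x \<in> A" for x
  proof -
    obtain n where n: "n \<ge> 1" "x \<in> set (subst_pow s n x)" using rec[OF x] by blast
    then have "x \<in> set (subst_pow s (k * n) x)"
      using subst_pow_recurrent_mult[of x s n k] by (simp add: mult.commute)
    with set_k[OF n(1) x] show ?thesis by simp
  qed
  show ?thesis
  proof (intro exI[of _ "k * 4"] conjI allI impI ballI)
    show "k * 4 > 0" using k(1) by simp
    show "x \<in> set (subst_pow s (k * 4) x)" if "x \<in> A" for x
      using set_k[of 4 x] self that by simp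
    show "count_list (subst_pow s (k * 4) x) x \<ge> 3"
      if "x \<in> A" "y \<in> A" "x \<noteq> y" "y \<in> set (subst_pow s (k * 4) x)" "x \<in> set (subst_pow s (k * 4) y)" for x y
      using count_list_subst_pow_4[of x y s k] that set_k[of 4] self by simp
    fix j x and S :: "'a set" assume "j \<ge> (1::nat)" "x \<in> A"
    then show "find (\<lambda>z. z \<in> S) (subst_pow s (k * 4 * j) x) = find (\<lambda>z. z \<in> S) (subst_pow s (k * 4) x)"
      using k(2) by (simp add: mult.assoc)
    show "find (\<lambda>z. z \<in> S) (rev (subst_pow s (k * 4 * j) x)) = find (\<lambda>z. z \<in> S) (rev (subst_pow s (k * 4) x))"
      using k(2) \<open>j \<ge> 1\<close> \<open>x \<in> A\<close> by (simp add: mult.assoc)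
  qed
qed

section \<open>Words in a free group\<close>

definition pos_word :: "'a list \<Rightarrow> ('a \<times> bool) list" where
  "pos_word w = map (\<lambda>a. (a, True)) w"

lemma word_value_Nil [simp]: "word_value G [] = \<one>\<^bsub>G\<^esub>"
  by (simp add: word_value_def)

lemma word_value_Cons [simp]:
  "word_value G ((a, e) # w) = (if e then a else inv\<^bsub>G\<^esub> a) \<otimes>\<^bsub>G\<^esub> word_value G w"
  by (simp add: word_value_def)

lemma (in group) word_value_closed:
  "fst ` set w \<subseteq> carrier G \<Longrightarrow> word_value G w \<in> carrier G"
  by (induction w) auto

lemma (in group) word_value_append:
  "fst ` set u \<subseteq> carrier G \<Longrightarrow> fst ` set v \<subseteq> carrier G \<Longrightarrow>
     word_value G (u @ v) = word_value G u \<otimes> word_value G v"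
proof (induction u)
  case (Cons p u)
  then show ?case by (cases p) (auto simp: word_value_closed m_assoc)
qed (simp add: word_value_closed)

lemma (in group) word_value_cancel:
  assumes "fst ` set (u @ [(a, e), (a, \<not> e)] @ v) \<subseteq> carrier G"
  shows "word_value G (u @ [(a, e), (a, \<not> e)] @ v) = word_value G (u @ v)"
proof -
  have "a \<in> carrier G" "word_value G v \<in> carrier G" using assms by (auto intro: word_value_closed)
  then have "word_value G ([(a, e), (a, \<not> e)] @ v) = word_value G v"
    by (auto simp: m_assoc[symmetric])
  moreover have "word_value G (u @ [(a, e), (a, \<not> e)] @ v) =
      word_value G u \<otimes> word_value G ([(a, e), (a, \<not> e)] @ v)"
    using assms by (intro word_value_append) auto
  moreover have "word_value G (u @ v) = word_value G u \<otimes> word_value G v"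
    using assms by (intro word_value_append) auto
  ultimately show ?thesis by simp
qed

lemma not_successively_split:
  "\<not> successively P w \<Longrightarrow> \<exists>u a b v. w = u @ [a, b] @ v \<and> \<not> P a b"
proof (induction P w rule: successively.induct)
  case (3 P a b w)
  then consider "\<not> P a b" | "\<not> successively P (b # w)" by auto
  then show ?case
  proof cases
    case 1
    then show ?thesis by (metis append_Cons append_Nil)
  next
    case 2
    have "\<exists>u c d v. b # w = u @ [c, d] @ v \<and> \<not> P c d"
      using 3 2 by auto
    then show ?thesis by (metis append_Cons)
  qed
qed auto

lemma reduced_word_eqI:
  assumes "free_basis G A" "w \<in> reduced_words A" "word_value G w = g" "g \<in> carrier G"
  shows "reduced_word G A g = w"
  using assms reduced_word_correct[OF assms(1,4)] unfolding free_basis_def by metis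

lemma (in group) reduced_word_parity:
  assumes fb: "free_basis G A" and w: "fst ` set w \<subseteq> A"
  shows "odd (length (filter g (map fst (reduced_word G A (word_value G w))))) =
         odd (length (filter g (map fst w)))"
  using w
proof (induction w rule: length_induct)
  case (1 w)
  have AG: "A \<subseteq> carrier G" using fb by (simp add: free_basis_def)
  show ?case
  proof (cases "w \<in> reduced_words A")
    case True
    then show ?thesis
      using reduced_word_eqI[OF fb True refl] word_value_closed[of w] 1 AG by auto
  next
    case False
    then have "\<not> successively (\<lambda>(a, e) (b, f). \<not> (a = b \<and> e \<noteq> f)) w"
      using 1 by (auto simp: reduced_words_def)
    then obtain u a e b f v where "w = u @ [(a, e), (b, f)] @ v" "a = b" "e \<noteq> f"
      using not_successively_split by fastforce
    then have w: "w = u @ [(a, e), (a, \<not> e)] @ v" by auto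
    have "word_value G w = word_value G (u @ v)"
      unfolding w by (rule word_value_cancel) (use 1 AG w in auto)
    moreover have "length (u @ v) < length w" "fst ` set (u @ v) \<subseteq> A"
      using 1 w by auto
    ultimately show ?thesis using 1 w by auto
  qed
qed

lemma pos_word_simps [simp]:
  "pos_word [] = []" "pos_word (a # w) = (a, True) # pos_word w"
  "pos_word (u @ v) = pos_word u @ pos_word v" "fst ` set (pos_word w) = set w"
  "map fst (pos_word w) = w" "(a, True) \<in> set (pos_word w) \<longleftrightarrow> a \<in> set w"
  "pos_word w = [] \<longleftrightarrow> w = []" "count_list (pos_word w) (a, True) = count_list w a"
proof -
  show "count_list (pos_word w) (a, True) = count_list w a"
    by (induction w) (auto simp: pos_word_def)
qed (auto simp: pos_word_def image_iff comp_def)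

lemma pos_word_reduced: "set w \<subseteq> A \<Longrightarrow> pos_word w \<in> reduced_words A"
  by (induction w rule: induct_list012) (auto simp: reduced_words_def)

lemma leftmost_letter_from_pos_word:
  "leftmost_letter_from S (pos_word w) z \<longleftrightarrow> find (\<lambda>z. z \<in> S) w = Some z"
proof (induction w)
  case Nil
  then show ?case by (simp add: leftmost_letter_from_def)
next
  case (Cons a w)
  have "leftmost_letter_from S ((a, True) # v) z \<longleftrightarrow>
      (if a \<in> S then a = z else leftmost_letter_from S v z)" for v
  proof -
    have "(\<exists>u t. (a, True) # v = u @ (z, True) # t \<and> fst ` set u \<inter> S = {}) \<longleftrightarrow>
        a = z \<or> a \<notin> S \<and> (\<exists>u t. v = u @ (z, True) # t \<and> fst ` set u \<inter> S = {})"
      (is "?L \<longleftrightarrow> ?R")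
    proof
      assume ?L
      then obtain u t where "(a, True) # v = u @ (z, True) # t" "fst ` set u \<inter> S = {}" by blast
      then show ?R by (cases u) auto
    next
      assume ?R
      then show ?L
      proof (elim disjE conjE exE)
        assume "a = z"
        then show ?L by (intro exI[of _ "[]"] exI[of _ v]) simp
      next
        fix u t assume "a \<notin> S" "v = u @ (z, True) # t" "fst ` set u \<inter> S = {}"
        then show ?L by (intro exI[of _ "(a, True) # u"] exI[of _ t]) simp
      qed
    qed
    then show ?thesis unfolding leftmost_letter_from_def by auto
  qed
  with Cons show ?case by simp
qed

lemma rightmost_letter_from_rev:
  "rightmost_letter_from S w z \<longleftrightarrow> leftmost_letter_from S (rev w) z"
proof -
  have "(\<exists>u v. w = u @ (z, True) # v \<and> fst ` set v \<inter> S = {}) \<longleftrightarrow>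
        (\<exists>u v. rev w = u @ (z, True) # v \<and> fst ` set u \<inter> S = {})" (is "?L \<longleftrightarrow> ?R")
  proof
    assume ?L
    then obtain u v where "w = u @ (z, True) # v" "fst ` set v \<inter> S = {}" by blast
    then have "rev w = rev v @ (z, True) # rev u" "fst ` set (rev v) \<inter> S = {}" by auto
    then show ?R by blast
  next
    assume ?R
    then obtain u v where "rev w = u @ (z, True) # v" "fst ` set u \<inter> S = {}" by blast
    then have "w = rev v @ (z, True) # rev u" "fst ` set (rev u) \<inter> S = {}"
      by (auto simp: rev_swap)
    then show ?L by blast
  qed
  then show ?thesis by (simp add: rightmost_letter_from_def leftmost_letter_from_def)
qed

lemma rightmost_letter_from_pos_word:
  "rightmost_letter_from S (pos_word w) z \<longleftrightarrow> find (\<lambda>z. z \<in> S) (rev w) = Some z"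
  using leftmost_letter_from_pos_word[of S "rev w" z]
  by (simp add: rightmost_letter_from_rev pos_word_def rev_map)

lemma (in group) hom_word_value_pos_word:
  assumes h: "\<phi> \<in> hom G G" and AG: "A \<subseteq> carrier G"
    and s: "\<And>y. y \<in> A \<Longrightarrow> set (s y) \<subseteq> A \<and> word_value G (pos_word (s y)) = \<phi> y"
    and w: "set w \<subseteq> A"
  shows "\<phi> (word_value G (pos_word w)) = word_value G (pos_word (concat (map s w)))"
  using w
proof (induction w)
  case Nil
  then show ?case using hom_one[OF h is_group is_group] by simp
next
  case (Cons a w)
  have sub: "set (concat (map s w)) \<subseteq> carrier G" "set (s a) \<subseteq> carrier G"
    using s Cons.prems AG by auto
  have "\<phi> (word_value G (pos_word (a # w))) = \<phi> a \<otimes> \<phi> (word_value G (pos_word w))"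
    using Cons.prems AG word_value_closed[of "pos_word w"] by (auto intro!: hom_mult[OF h])
  also have "\<dots> = word_value G (pos_word (s a)) \<otimes> word_value G (pos_word (concat (map s w)))"
    using Cons s by simp
  also have "\<dots> = word_value G (pos_word (concat (map s (a # w))))"
    using word_value_append[of "pos_word (s a)" "pos_word (concat (map s w))"] sub by simp
  finally show ?case .
qed

lemma (in group) reduced_word_funpow:
  assumes fb: "free_basis G A" and h: "\<phi> \<in> hom G G"
    and s: "\<And>y. y \<in> A \<Longrightarrow> set (s y) \<subseteq> A \<and> word_value G (pos_word (s y)) = \<phi> y"
    and x: "x \<in> A"
  shows "reduced_word G A ((\<phi> ^^ n) x) = pos_word (subst_pow s n x)"
proof -
  have AG: "A \<subseteq> carrier G" using fb by (simp add: free_basis_def)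
  have sub: "set (subst_pow s n x) \<subseteq> A" for n
    using s x by (intro set_subst_pow_subset) auto
  have val: "word_value G (pos_word (subst_pow s n x)) = (\<phi> ^^ n) x" for n
  proof (induction n)
    case 0
    then show ?case using AG x by auto
  next
    case (Suc n)
    have "(\<phi> ^^ Suc n) x = \<phi> (word_value G (pos_word (subst_pow s n x)))"
      by (simp add: Suc)
    then show ?case using hom_word_value_pos_word[OF h AG s sub] by simp
  qed
  have "(\<phi> ^^ n) x \<in> carrier G"
    using word_value_closed[of "pos_word (subst_pow s n x)"] sub AG val by auto
  with val show ?thesis
    by (intro reduced_word_eqI[OF fb pos_word_reduced[OF sub]]) auto
qed

text \<open>
  The \<open>f\<close> below is the restriction to \<open>A\<close> of \<open>h \<circ> \<phi>\<inverse>\<close>, where \<open>h\<close> is the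
  homomorphism to \<open>\<int>/2\<close> that extends \<open>g\<close>.
\<close>

lemma (in group) iso_parity_surj:
  assumes fb: "free_basis G A" and iso: "\<phi> \<in> iso G G"
    and s: "\<And>y. y \<in> A \<Longrightarrow> set (s y) \<subseteq> A \<and> word_value G (pos_word (s y)) = \<phi> y"
  shows "\<exists>f. \<forall>y\<in>A. g y = odd (length (filter f (s y)))"
proof -
  have AG: "A \<subseteq> carrier G" using fb by (simp add: free_basis_def)
  define \<psi> where "\<psi> = inv_into (carrier G) \<phi>"
  have \<psi>: "\<psi> \<in> hom G G"
    using iso_set_sym[OF iso] by (simp add: \<psi>_def iso_def)
  define h where "h u = odd (length (filter g (map fst (reduced_word G A u))))" for u
  have h_val: "h (word_value G w) = odd (length (filter g (map fst w)))" if "fst ` set w \<subseteq> A" for w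
    unfolding h_def using reduced_word_parity[OF fb that] .
  have h_mult: "h (u \<otimes> v) = (h u \<noteq> h v)" if "u \<in> carrier G" "v \<in> carrier G" for u v
  proof -
    let ?u = "reduced_word G A u" and ?v = "reduced_word G A v"
    have sub: "fst ` set ?u \<subseteq> A" "fst ` set ?v \<subseteq> A"
      using reduced_word_correct(1)[OF fb] that by (auto simp: reduced_words_def)
    have "word_value G (?u @ ?v) = u \<otimes> v"
      using word_value_append[of ?u ?v] sub AG reduced_word_correct(2)[OF fb] that by auto
    then have "h (u \<otimes> v) = odd (length (filter g (map fst (?u @ ?v))))"
      using h_val[of "?u @ ?v"] sub by auto
    then show ?thesis by (simp add: h_def)
  qed
  have *: "h (\<psi> (word_value G (pos_word w))) = odd (length (filter (\<lambda>y. h (\<psi> y)) w))"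
    if "set w \<subseteq> A" for w
    using that
  proof (induction w)
    case Nil
    then show ?case using hom_one[OF \<psi> is_group is_group] h_val[of "[]"] by simp
  next
    case (Cons a w)
    have cl: "a \<in> carrier G" "word_value G (pos_word w) \<in> carrier G"
      using Cons.prems AG word_value_closed[of "pos_word w"] by auto
    then have "\<psi> (a \<otimes> word_value G (pos_word w)) = \<psi> a \<otimes> \<psi> (word_value G (pos_word w))"
      by (rule hom_mult[OF \<psi>])
    then show ?case
      using Cons h_mult hom_in_carrier[OF \<psi>] cl by auto
  qed
  have "g y = odd (length (filter (\<lambda>y. h (\<psi> y)) (s y)))" if y: "y \<in> A" for y
  proof -
    have "\<psi> (\<phi> y) = y"
      using iso y AG unfolding \<psi>_def iso_def bij_betw_def by (auto intro: inv_into_f_f)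
    moreover have "h y = g y"
      using h_val[of "[(y, True)]"] y subsetD[OF AG y] by simp
    ultimately show ?thesis using *[of "s y"] s[OF y] by simp
  qed
  then show ?thesis by blast
qed

theorem proposition1p4p5:
  fixes F :: "('a, 'b) monoid_scheme" and A :: "'a set" and \<phi> :: "'a \<Rightarrow> 'a"
  assumes "group F"
    and "finite A"
    and "free_basis F A"
    and "\<phi> \<in> iso F F"
    and "positive_on_basis F A \<phi>"
  shows "\<exists>k::nat. k > 0 \<and> (let \<psi> = \<phi> ^^ k; W = reduced_word F A in
      (\<forall>x\<in>A. (x, True) \<in> set (W (\<psi> x)))
    \<and> (\<forall>x\<in>A. exponential_letter F A \<psi> x \<longrightarrow> count_list (W (\<psi> x)) (x, True) \<ge> 3)
    \<and> (\<forall>x\<in>A. \<forall>y \<in> Supp F A \<psi> x. (y, True) \<in> set (W (\<psi> x)))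
    \<and> (\<forall>x\<in>A. \<forall>j\<ge>1.
          W ((\<psi> ^^ j) x) \<noteq> [] \<and> W (\<psi> x) \<noteq> []
        \<and> hd (W ((\<psi> ^^ j) x)) = hd (W (\<psi> x))
        \<and> last (W ((\<psi> ^^ j) x)) = last (W (\<psi> x)))
    \<and> (\<forall>x\<in>A. \<forall>j\<ge>1. \<forall>S \<in> stratum F A \<psi> ` A. S \<subseteq> Supp F A \<psi> x \<longrightarrow>
          (\<exists>z. leftmost_letter_from S (W ((\<psi> ^^ j) x)) z \<and> leftmost_letter_from S (W (\<psi> x)) z)
        \<and> (\<exists>z. rightmost_letter_from S (W ((\<psi> ^^ j) x)) z \<and> rightmost_letter_from S (W (\<psi> x)) z)))"
proof -
  interpret group F by fact
  note fb = assms(3)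
  have AF: "A \<subseteq> carrier F" using fb by (simp add: free_basis_def)
  have hom: "\<phi> \<in> hom F F" using assms(4) by (simp add: iso_def)
  define s where "s y = map fst (reduced_word F A (\<phi> y))" for y
  have s: "set (s y) \<subseteq> A \<and> word_value F (pos_word (s y)) = \<phi> y" if y: "y \<in> A" for y
  proof -
    have c: "\<phi> y \<in> carrier F" using hom_in_carrier[OF hom] y AF by blast
    note r = reduced_word_correct[OF fb c]
    have sub: "fst ` set (reduced_word F A (\<phi> y)) \<subseteq> A"
      using r(1) by (simp add: reduced_words_def)
    have "snd p" if p: "p \<in> set (reduced_word F A (\<phi> y))" for p
    proof (rule ccontr)
      assume "\<not> snd p"
      then have "p = (fst p, False)" by (simp add: prod_eq_iff)
      moreover have "fst p \<in> A" using sub p by blast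
      ultimately show False using assms(5) y p unfolding positive_on_basis_def by metis
    qed
    then have "map (\<lambda>p. (fst p, True)) (reduced_word F A (\<phi> y)) = reduced_word F A (\<phi> y)"
      by (intro map_idI) (metis prod.collapse)
    then have "pos_word (s y) = reduced_word F A (\<phi> y)"
      by (simp add: pos_word_def s_def comp_def)
    then show ?thesis using sub r(2) by (simp add: s_def)
  qed
  then have closed: "\<forall>y\<in>A. set (s y) \<subseteq> A" by blast
  have rec: "\<exists>n\<ge>1. x \<in> set (subst_pow s n x)" if "x \<in> A" for x
    using subst_pow_recurrent[OF assms(2) closed iso_parity_surj[OF fb assms(4) s] that] .
  obtain K where K: "K > 0"
    "\<forall>x\<in>A. x \<in> set (subst_pow s K x)"
    "\<forall>x\<in>A. \<forall>y\<in>A. x \<noteq> y \<longrightarrow> y \<in> set (subst_pow s K x) \<longrightarrow>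
       x \<in> set (subst_pow s K y) \<longrightarrow> count_list (subst_pow s K x) x \<ge> 3"
    and stable: "\<forall>j\<ge>1. \<forall>x\<in>A. \<forall>S.
       find (\<lambda>z. z \<in> S) (subst_pow s (K * j) x) = find (\<lambda>z. z \<in> S) (subst_pow s K x) \<and>
       find (\<lambda>z. z \<in> S) (rev (subst_pow s (K * j) x)) = find (\<lambda>z. z \<in> S) (rev (subst_pow s K x))"
    using subst_pow_good_power[OF assms(2) closed rec] by blast
  have left: "find (\<lambda>z. z \<in> S) (subst_pow s (K * j) x) = find (\<lambda>z. z \<in> S) (subst_pow s K x)"
    and right: "find (\<lambda>z. z \<in> S) (rev (subst_pow s (K * j) x)) = find (\<lambda>z. z \<in> S) (rev (subst_pow s K x))"
    if "j \<ge> 1" "x \<in> A" for j x S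
    using stable that by blast+
  define \<psi> where "\<psi> = \<phi> ^^ K"
  have Wj: "reduced_word F A ((\<psi> ^^ j) x) = pos_word (subst_pow s (K * j) x)" if "x \<in> A" for j x
    unfolding \<psi>_def funpow_mult using reduced_word_funpow[OF fb hom s that] .
  have W: "reduced_word F A (\<psi> x) = pos_word (subst_pow s K x)" if "x \<in> A" for x
    using Wj[OF that, of 1] by simp
  have set_K: "set (subst_pow s (K * j) x) = set (subst_pow s K x)" if "j \<ge> 1" "x \<in> A" for j x
    using left[OF that] by (rule set_eq_of_find_eq)
  have sub: "set (subst_pow s n x) \<subseteq> A" if "x \<in> A" for n x
    using set_subst_pow_subset[OF closed that] .
  have Supp: "Supp F A \<psi> x = set (subst_pow s K x)" if x: "x \<in> A" for x
  proof -
    have "set (subst_pow s (K * j) x) \<subseteq> set (subst_pow s K x)" for j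
      using set_K[of j x] bspec[OF K(2) x] x by (cases j) auto
    then have "Supp F A \<psi> x \<subseteq> set (subst_pow s K x)"
      unfolding Supp_def by (auto simp: Wj[OF x])
    moreover have "set (subst_pow s K x) \<subseteq> Supp F A \<psi> x"
      unfolding Supp_def Wj[OF x] using sub[OF x, of K] by (auto intro!: exI[of _ 1])
    ultimately show ?thesis by auto
  qed
  have stratum_self: "x \<in> stratum F A \<psi> x" if "x \<in> A" for x
    using bspec[OF K(2) that] Supp[OF that] by (simp add: stratum_def)
  have P2: "count_list (reduced_word F A (\<psi> x)) (x, True) \<ge> 3" if exp: "exponential_letter F A \<psi> x" for x
  proof -
    obtain y where y: "x \<in> A" "y \<in> A" "y \<noteq> x" "stratum F A \<psi> x = stratum F A \<psi> y"
      using exp by (auto simp: exponential_letter_def)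
    then have "y \<in> Supp F A \<psi> x" "x \<in> Supp F A \<psi> y"
      using stratum_self[of x] stratum_self[of y] by (auto simp: stratum_def)
    then show ?thesis using K(3) y Supp W by auto
  qed
  have find_A: "find (\<lambda>z. z \<in> A) w = Some (hd w)" if "w \<noteq> []" "set w \<subseteq> A" for w
    using that by (cases w) auto
  have P4: "reduced_word F A ((\<psi> ^^ j) x) \<noteq> [] \<and> reduced_word F A (\<psi> x) \<noteq> []
      \<and> hd (reduced_word F A ((\<psi> ^^ j) x)) = hd (reduced_word F A (\<psi> x))
      \<and> last (reduced_word F A ((\<psi> ^^ j) x)) = last (reduced_word F A (\<psi> x))"
    if x: "x \<in> A" and j: "j \<ge> 1" for x j
  proof -
    let ?u = "subst_pow s (K * j) x" and ?v = "subst_pow s K x"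
    have ne: "?u \<noteq> []" "?v \<noteq> []"
      using bspec[OF K(2) x] set_K[OF j x] by auto
    have "hd ?u = hd ?v"
      using left[OF j x, of A] find_A[OF ne(1) sub[OF x]] find_A[OF ne(2) sub[OF x]] by simp
    moreover have "hd (rev ?u) = hd (rev ?v)"
      using right[OF j x, of A] find_A[of "rev ?u"] find_A[of "rev ?v"] ne sub[OF x] by simp
    ultimately show ?thesis
      using ne unfolding Wj[OF x] W[OF x]
      by (simp add: hd_rev) (simp add: pos_word_def hd_map last_map)
  qed
  have P5: "(\<exists>z. leftmost_letter_from S (reduced_word F A ((\<psi> ^^ j) x)) z
        \<and> leftmost_letter_from S (reduced_word F A (\<psi> x)) z)
      \<and> (\<exists>z. rightmost_letter_from S (reduced_word F A ((\<psi> ^^ j) x)) z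
        \<and> rightmost_letter_from S (reduced_word F A (\<psi> x)) z)"
    if x: "x \<in> A" and j: "j \<ge> 1" and S: "S \<in> stratum F A \<psi> ` A" "S \<subseteq> Supp F A \<psi> x" for x j S
  proof -
    obtain y where "y \<in> S" "y \<in> set (subst_pow s K x)"
      using S stratum_self Supp[OF x] by blast
    then have "find (\<lambda>z. z \<in> S) (subst_pow s K x) \<noteq> None" "find (\<lambda>z. z \<in> S) (rev (subst_pow s K x)) \<noteq> None"
      by (auto simp: find_None_iff)
    then show ?thesis
      unfolding Wj[OF x] W[OF x] leftmost_letter_from_pos_word rightmost_letter_from_pos_word
        left[OF j x] right[OF j x] by auto
  qed
  have P1: "(x, True) \<in> set (reduced_word F A (\<psi> x))" if "x \<in> A" for x
    using K(2) W that by simp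
  have P3: "(y, True) \<in> set (reduced_word F A (\<psi> x))" if "x \<in> A" "y \<in> Supp F A \<psi> x" for x y
    using Supp W that by simp
  show ?thesis
    unfolding Let_def
    by (intro exI[of _ K] conjI[OF K(1)], fold \<psi>_def, intro conjI ballI allI impI)
      (use P1 P2 P3 P4 P5 in blast)+
qed

end
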